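(* Let $F$ be a noncyclic free group, let $g\in F$ and let $\ell\ge 1$ be an integer. Then the $(\ell+1)$-subnormal closure $\langle g\rangle_{\ell+1}^{F}$ of $g$ in $F$ contains no nontrivial $\ell$-subnormal subgroups of $F$. In particular, it contains no nontrivial normal subgroups of $F$.
   Context: A subgroup $K$ of a group $G$ is called $\ell$-subnormal in $G$ ($\ell=1,2,\dots$) if there is a decreasing sequence $G\triangleright K_1\triangleright\dots\triangleright K_{\ell}=K$ in which each term is a normal subgroup of the preceding one (not necessarily proper). For an element $g\in G$, the $\ell$-subnormal closure $\langle g\rangle_{\ell}^{G}$ is defined by induction: $\langle g\rangle_1^{G}$ is the normal closure of $g$ in $G$ (the smallest normal subgroup of $G$ containing $g$), and for $\ell\ge 2$, $\langle g\rangle_{\ell}^{G}$ is the normal closure of $g$ in the group $\langle g\rangle_{\ell-1}^{G}$. *)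

theory Defs
  imports "HOL-Algebra.Elementary_Groups"
begin

text \<open>
  A word over a set \<open>B\<close> of group elements is a list of letters \<open>(b, x)\<close> with \<open>x \<in> B\<close>, where
  \<open>(True, x)\<close> stands for \<open>x\<close> and \<open>(False, x)\<close> for the formal inverse of \<open>x\<close>.
\<close>

fun reduced_word :: "(bool \<times> 'a) list \<Rightarrow> bool" where
  "reduced_word (p # q # w) \<longleftrightarrow> \<not> (snd p = snd q \<and> fst p \<noteq> fst q) \<and> reduced_word (q # w)"
| "reduced_word _ \<longleftrightarrow> True"

definition word_value :: "('a, 'b) monoid_scheme \<Rightarrow> (bool \<times> 'a) list \<Rightarrow> 'a" where
  "word_value G w =
     foldr (\<lambda>(b, x) y. (if b then x else inv\<^bsub>G\<^esub> x) \<otimes>\<^bsub>G\<^esub> y) w \<one>\<^bsub>G\<^esub>"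

text \<open>
  \<open>B\<close> is a free basis of \<open>G\<close>: every element of \<open>G\<close> is the value of exactly one reduced word
  over \<open>B\<close>. No finiteness of \<open>B\<close> is required.
\<close>

definition free_basis :: "('a, 'b) monoid_scheme \<Rightarrow> 'a set \<Rightarrow> bool" where
  "free_basis G B \<longleftrightarrow>
     B \<subseteq> carrier G \<and>
     bij_betw (word_value G) {w \<in> lists (UNIV \<times> B). reduced_word w} (carrier G)"

definition free_group :: "('a, 'b) monoid_scheme \<Rightarrow> bool" where
  "free_group G \<longleftrightarrow> group G \<and> (\<exists>B. free_basis G B)"

definition subnormal :: "nat \<Rightarrow> 'a set \<Rightarrow> ('a, 'b) monoid_scheme \<Rightarrow> bool" where
  "subnormal l K G \<longleftrightarrow>
     (\<exists>H :: nat \<Rightarrow> 'a set. H 0 = carrier G \<and> H l = K \<and>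
        (\<forall>i < l. H (Suc i) \<lhd> G\<lparr>carrier := H i\<rparr>))"

definition normal_closure :: "('a, 'b) monoid_scheme \<Rightarrow> 'a \<Rightarrow> 'a set" where
  "normal_closure G g = \<Inter> {N. N \<lhd> G \<and> g \<in> N}"

lemma normal_closure_least:
  assumes "N \<lhd> G" "g \<in> N"
  shows "normal_closure G g \<subseteq> N"
  using assms by (auto simp: normal_closure_def)

lemma (in group) normal_closure_normal:
  assumes "g \<in> carrier G"
  shows "normal_closure G g \<lhd> G" "g \<in> normal_closure G g"
proof -
  let ?C = "{N. N \<lhd> G \<and> g \<in> N}"
  have "carrier G \<in> ?C"
    using assms by (auto intro!: normal_invI subgroup_self)
  hence "subgroup (\<Inter> ?C) G"
    by (intro subgroups_Inter) (auto simp: normal_imp_subgroup)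
  thus "normal_closure G g \<lhd> G"
    by (auto simp: normal_closure_def normal_inv_iff)
  show "g \<in> normal_closure G g"
    by (auto simp: normal_closure_def)
qed

text \<open>
  The \<open>l\<close>-subnormal closure of \<open>g\<close> for \<open>l \<ge> 1\<close>. Starting the recursion with \<open>carrier G\<close> at \<open>0\<close>
  makes the value at \<open>1\<close> the normal closure of \<open>g\<close> in \<open>G\<close>.
\<close>

primrec subnormal_closure :: "('a, 'b) monoid_scheme \<Rightarrow> 'a \<Rightarrow> nat \<Rightarrow> 'a set" where
  "subnormal_closure G g 0 = carrier G"
| "subnormal_closure G g (Suc l) = normal_closure (G\<lparr>carrier := subnormal_closure G g l\<rparr>) g"

lemma subnormal_closure_1: "subnormal_closure G g 1 = normal_closure G g"
  by simp

end

theory Submission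
  imports Defs
begin

text \<open>
  Let \<open>K\<close> be \<open>l\<close>-subnormal in \<open>F\<close>, with chain \<open>F = H\<^sub>0, H\<^sub>1, \<dots>, H\<^sub>l = K\<close>, and let \<open>K\<close> lie in the
  \<open>(l + 1)\<close>-subnormal closure of \<open>g\<close>. Given \<open>k \<noteq> 1\<close> in \<open>K\<close>, one constructs a second chain
  \<open>F = P\<^sub>0, P\<^sub>1, \<dots>\<close>, each term normal in the preceding one and all of them containing \<open>g\<close>, together
  with elements \<open>h\<^sub>i \<in> P\<^sub>i \<inter> H\<^sub>i\<close> of infinite order modulo \<open>P\<^sub>i\<^sub>+\<^sub>1\<close>. The \<open>i\<close>-subnormal closure of
  \<open>g\<close> is contained in \<open>P\<^sub>i\<close>, whatever the choice of the \<open>P\<^sub>i\<close>. For \<open>i = l\<close> this is absurd: \<open>h\<^sub>l\<close> lies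
  in \<open>H\<^sub>l = K\<close>, hence in the \<open>(l + 1)\<close>-subnormal closure of \<open>g\<close>, hence in \<open>P\<^sub>l\<^sub>+\<^sub>1\<close>.

  The chain starts with the kernel \<open>P\<^sub>1\<close> of a nonzero homomorphism from \<open>F\<close> to the integers that
  kills \<open>g\<close>, and with a basis element \<open>h\<^sub>0\<close> outside \<open>P\<^sub>1\<close>; such a homomorphism exists because \<open>F\<close> has
  at least two basis elements (\<open>exists_infinite_cyclic_quotient\<close>).

  The chain is continued by \<open>conjugate_avoiding_kernel\<close>. Write \<open>M = P\<^sub>i\<^sub>+\<^sub>1\<close> and \<open>h = h\<^sub>i\<close>. The
  Schreier graph of \<open>M\<close> has the right cosets of \<open>M\<close> as vertices and an edge from \<open>M f\<close> to \<open>M f x\<close>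
  for every basis element \<open>x\<close>. Reading words as edge paths from the base vertex embeds \<open>M\<close>
  into the free group on the set of edges: a reduced word gives a reduced path. Left
  multiplication by \<open>h\<close> acts on the graph, and the path of \<open>h\<^sup>n k h\<^sup>-\<^sup>n\<close> is, up to conjugation, the
  translate by \<open>h\<^sup>n\<close> of the path of \<open>k\<close>. No positive power of \<open>h\<close> lies in \<open>M\<close>, so for some \<open>n\<close> this
  translate avoids the finite set \<open>S\<close> of edges on the path of \<open>g\<close>. Let \<open>P\<^sub>i\<^sub>+\<^sub>2\<close> consist of the
  elements of \<open>M\<close> whose path becomes trivial when the edges in \<open>S\<close> are deleted. It is normal in
  \<open>M\<close> and contains \<open>g\<close>, whereas \<open>h\<^sub>i\<^sub>+\<^sub>1 = h\<^sup>n k h\<^sup>-\<^sup>n\<close> is mapped to a conjugate of the unchanged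
  translate, a nontrivial element of a free group and therefore of infinite order. Finally
  \<open>h\<^sub>i\<^sub>+\<^sub>1\<close> lies in \<open>H\<^sub>i\<^sub>+\<^sub>1\<close>, since \<open>k\<close> does and \<open>h \<in> H\<^sub>i\<close> normalizes \<open>H\<^sub>i\<^sub>+\<^sub>1\<close>.
\<close>

section \<open>Free reduction of words\<close>

definition inv_letter :: "bool \<times> 'c \<Rightarrow> bool \<times> 'c" where
  "inv_letter a = (\<not> fst a, snd a)"

definition inv_word :: "(bool \<times> 'c) list \<Rightarrow> (bool \<times> 'c) list" where
  "inv_word w = rev (map inv_letter w)"

definition cancel_cons :: "bool \<times> 'c \<Rightarrow> (bool \<times> 'c) list \<Rightarrow> (bool \<times> 'c) list" where
  "cancel_cons a w = (if w \<noteq> [] \<and> hd w = inv_letter a then tl w else a # w)"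

definition reduce :: "(bool \<times> 'c) list \<Rightarrow> (bool \<times> 'c) list" where
  "reduce w = foldr cancel_cons w []"

lemma inv_letter_simps [simp]:
  "inv_letter (inv_letter a) = a" "inv_letter a \<noteq> a" "a \<noteq> inv_letter a"
  "fst (inv_letter a) = (\<not> fst a)" "snd (inv_letter a) = snd a"
  by (cases a; simp add: inv_letter_def)+

lemma inv_letter_eq_iff [simp]: "inv_letter a = inv_letter b \<longleftrightarrow> a = b"
  by (metis inv_letter_simps(1))

lemma eq_inv_letter_iff: "b = inv_letter a \<longleftrightarrow> snd a = snd b \<and> fst a \<noteq> fst b"
  by (cases a; cases b) (auto simp: inv_letter_def)

lemma inv_letter_in_lists: "inv_letter a \<in> UNIV \<times> B \<longleftrightarrow> a \<in> UNIV \<times> B"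
  by (cases a) (auto simp: inv_letter_def)

lemma inv_word_simps [simp]:
  "inv_word [] = []" "inv_word (a # w) = inv_word w @ [inv_letter a]"
  "inv_word (u @ w) = inv_word w @ inv_word u"
  by (simp_all add: inv_word_def)

lemma inv_word_inv_word [simp]: "inv_word (inv_word w) = w"
  by (induction w) auto

lemma inv_word_in_lists: "w \<in> lists (UNIV \<times> B) \<Longrightarrow> inv_word w \<in> lists (UNIV \<times> B)"
  by (induction w) (auto simp: inv_letter_def)

lemma reduced_word_Cons:
  "reduced_word (a # w) \<longleftrightarrow> (w = [] \<or> hd w \<noteq> inv_letter a) \<and> reduced_word w"
  by (cases w) (auto simp: eq_inv_letter_iff)

lemma reduced_word_append:
  "reduced_word (u @ v) \<longleftrightarrow>
     reduced_word u \<and> reduced_word v \<and> (u = [] \<or> v = [] \<or> hd v \<noteq> inv_letter (last u))"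
  by (induction u) (auto simp: reduced_word_Cons hd_append)

lemma cancel_cons_inv_letter [simp]: "cancel_cons a (inv_letter a # v) = v"
  by (simp add: cancel_cons_def)

lemma cancel_cons_eq_Cons:
  "\<not> (w \<noteq> [] \<and> hd w = inv_letter a) \<Longrightarrow> cancel_cons a w = a # w"
  by (auto simp: cancel_cons_def)

lemma reduced_cancel_cons: "reduced_word w \<Longrightarrow> reduced_word (cancel_cons a w)"
  by (cases w) (auto simp: cancel_cons_def reduced_word_Cons)

text \<open>
  Every letter thus acts as a permutation of the set of reduced words. This gives uniqueness of
  reduced forms without a confluence argument: the action of a word depends only on
  its class modulo free reduction.
\<close>

lemma cancel_cons_inverse:
  "reduced_word w \<Longrightarrow> cancel_cons (inv_letter a) (cancel_cons a w) = w"
  by (cases w; cases "tl w") (auto simp: cancel_cons_def reduced_word_Cons)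

lemma cancel_cons_inverse':
  "reduced_word w \<Longrightarrow> cancel_cons a (cancel_cons (inv_letter a) w) = w"
  using cancel_cons_inverse[of w "inv_letter a"] by simp

lemma reduced_foldr_cancel_cons: "reduced_word w \<Longrightarrow> reduced_word (foldr cancel_cons u w)"
  by (induction u) (auto intro: reduced_cancel_cons)

lemma reduced_reduce: "reduced_word (reduce w)"
  by (simp add: reduce_def reduced_foldr_cancel_cons)

lemma reduce_simps [simp]:
  "reduce [] = []" "reduce (a # w) = cancel_cons a (reduce w)"
  by (simp_all add: reduce_def)

lemma reduce_reduced: "reduced_word w \<Longrightarrow> reduce w = w"
  by (induction w) (auto simp: reduced_word_Cons cancel_cons_def)

lemma reduce_reduce [simp]: "reduce (reduce w) = reduce w"
  by (simp add: reduce_reduced reduced_reduce)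

lemma reduce_append: "reduce (u @ v) = foldr cancel_cons u (reduce v)"
  by (simp add: reduce_def)

lemma foldr_cancel_cons_reduce:
  "reduced_word w \<Longrightarrow> foldr cancel_cons (reduce u) w = foldr cancel_cons u w"
proof (induction u)
  case (Cons a u)
  have red: "reduced_word (foldr cancel_cons v w)" for v
    using Cons.prems by (rule reduced_foldr_cancel_cons)
  show ?case
  proof (cases "reduce u \<noteq> [] \<and> hd (reduce u) = inv_letter a")
    case True
    then obtain v where v: "reduce u = inv_letter a # v"
      by (metis list.collapse)
    have "foldr cancel_cons (a # u) w = cancel_cons a (foldr cancel_cons (reduce u) w)"
      using Cons by simp
    also have "\<dots> = foldr cancel_cons v w"
      by (simp add: v cancel_cons_inverse' red)
    finally show ?thesis
      using v by simp
  next
    case False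
    thus ?thesis
      using Cons by (simp add: cancel_cons_eq_Cons)
  qed
qed auto

lemma reduce_cong:
  assumes "reduce u = reduce u'" "reduce v = reduce v'"
  shows "reduce (u @ v) = reduce (u' @ v')"
  by (metis assms foldr_cancel_cons_reduce reduce_append reduced_reduce)

lemma reduce_word_inv_word: "reduce (w @ inv_word w) = []"
proof (induction w)
  case (Cons a w)
  have "reduce ((w @ inv_word w) @ [inv_letter a]) = reduce ([] @ [inv_letter a])"
    using Cons by (intro reduce_cong) auto
  thus ?case
    by (simp add: cancel_cons_def)
qed auto

lemma reduce_inv_word_word: "reduce (inv_word w @ w) = []"
  using reduce_word_inv_word[of "inv_word w"] by simp

lemma reduce_conjugate_Nil:
  assumes "reduce (u @ d @ inv_word u) = []"
  shows "reduce d = []"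
proof -
  have "reduce d = reduce ((inv_word u @ u) @ d @ (inv_word u @ u))"
    using reduce_cong[of "[]" "inv_word u @ u" "d @ []" "d @ (inv_word u @ u)"]
      reduce_cong[of d d "[]" "inv_word u @ u"]
    by (simp add: reduce_inv_word_word)
  also have "\<dots> = reduce (inv_word u @ (u @ d @ inv_word u) @ u)"
    by simp
  also have "\<dots> = reduce (inv_word u @ [] @ u)"
    using assms by (intro reduce_cong) auto
  finally show ?thesis
    by (simp add: reduce_inv_word_word)
qed

lemma reduce_in_lists: "w \<in> lists A \<Longrightarrow> reduce w \<in> lists A"
proof (induction w)
  case (Cons a w)
  thus ?case by (cases "reduce w") (auto simp: cancel_cons_def)
qed auto

text \<open>
  A function that is insensitive to the insertion of a single cancelling pair is insensitive to
  reduction. This serves for the value of a word, for exponent sums and, through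
  \<open>reduce_map_reduce\<close> below, for operations that send words over one alphabet to words over
  another.
\<close>

lemma reduce_invariant:
  assumes "\<And>u a v. \<lbrakk>u \<in> lists A; a \<in> A; v \<in> lists A\<rbrakk> \<Longrightarrow> f (u @ a # inv_letter a # v) = f (u @ v)"
    and "w \<in> lists A"
  shows "f (reduce w) = f w"
  using assms(2,1)
proof (induction w arbitrary: f rule: lists.induct)
  case (Cons a w)
  have "f (a # reduce w) = f (a # w)"
  proof (rule Cons.IH[of "\<lambda>v. f (a # v)"])
    fix u b v assume "u \<in> lists A" "b \<in> A" "v \<in> lists A"
    thus "f (a # u @ b # inv_letter b # v) = f (a # u @ v)"
      using Cons.prems[of "a # u" b v] Cons.hyps by simp
  qed
  moreover have "f (reduce (a # w)) = f (a # reduce w)"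
  proof (cases "reduce w \<noteq> [] \<and> hd (reduce w) = inv_letter a")
    case True
    then obtain v where v: "reduce w = inv_letter a # v"
      by (metis list.collapse)
    have "v \<in> lists A"
      using reduce_in_lists[of w A] Cons.hyps v by simp
    thus ?thesis
      using Cons.prems[of "[]" a v] Cons.hyps v by (simp add: cancel_cons_def)
  qed (auto simp: cancel_cons_def)
  ultimately show ?case by simp
qed auto

lemma reduce_map_reduce:
  assumes "\<And>u a v. \<lbrakk>u \<in> lists A; a \<in> A; v \<in> lists A\<rbrakk>
             \<Longrightarrow> \<exists>u' c v'. f (u @ a # inv_letter a # v) = u' @ c @ inv_word c @ v' \<and> f (u @ v) = u' @ v'"
    and "w \<in> lists A"
  shows "reduce (f (reduce w)) = reduce (f w)"
proof (rule reduce_invariant[where f = "\<lambda>w. reduce (f w)", OF _ assms(2)])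
  fix u a v assume "u \<in> lists A" "a \<in> A" "v \<in> lists A"
  from assms(1)[OF this] obtain u' c v'
    where *: "f (u @ a # inv_letter a # v) = u' @ c @ inv_word c @ v'" "f (u @ v) = u' @ v'"
    by blast
  have "reduce (u' @ (c @ inv_word c) @ v') = reduce (u' @ [] @ v')"
    by (intro reduce_cong) (auto simp: reduce_word_inv_word)
  thus "reduce (f (u @ a # inv_letter a # v)) = reduce (f (u @ v))"
    by (simp add: *)
qed

text \<open>
  Deleting generators is a homomorphism of free groups, so it respects reduction.
\<close>

lemma reduce_filter_cong:
  assumes "reduce u = reduce v"
  shows "reduce (filter (\<lambda>a. snd a \<notin> S) u) = reduce (filter (\<lambda>a. snd a \<notin> S) v)"
proof -
  have "reduce (filter (\<lambda>a. snd a \<notin> S) (reduce w)) = reduce (filter (\<lambda>a. snd a \<notin> S) w)" for w :: "(bool \<times> 'a) list"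
  proof (rule reduce_map_reduce[of UNIV])
    fix u v :: "(bool \<times> 'a) list" and a
    show "\<exists>u' c v'. filter (\<lambda>a. snd a \<notin> S) (u @ a # inv_letter a # v) = u' @ c @ inv_word c @ v' \<and>
             filter (\<lambda>a. snd a \<notin> S) (u @ v) = u' @ v'"
      by (intro exI[of _ "filter (\<lambda>a. snd a \<notin> S) u"] exI[of _ "filter (\<lambda>a. snd a \<notin> S) v"]
          exI[of _ "filter (\<lambda>a. snd a \<notin> S) [a]"]) auto
  qed auto
  thus ?thesis by (metis assms)
qed

lemma filter_inv_word:
  "filter (\<lambda>a. snd a \<notin> S) (inv_word w) = inv_word (filter (\<lambda>a. snd a \<notin> S) w)"
  by (induction w) auto

lemma reduce_power_conjugate:
  "reduce (concat (replicate n (a # m @ [inv_letter a]))) =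
   reduce ([a] @ concat (replicate n m) @ inv_word [a])"
proof (induction n)
  case 0
  show ?case by (simp add: cancel_cons_def)
next
  case (Suc n)
  have "reduce ((a # m @ [inv_letter a]) @ concat (replicate n (a # m @ [inv_letter a]))) =
        reduce ((a # m @ [inv_letter a]) @ ([a] @ concat (replicate n m) @ inv_word [a]))"
    using Suc by (intro reduce_cong) auto
  also have "\<dots> = reduce ((a # m) @ (inv_word [a] @ [a]) @ (concat (replicate n m) @ inv_word [a]))"
    by simp
  also have "\<dots> = reduce ((a # m) @ [] @ (concat (replicate n m) @ inv_word [a]))"
    by (intro reduce_cong) (auto simp: cancel_cons_def)
  finally show ?case by simp
qed

text \<open>
  Free groups are torsion-free. A cyclically reduced word has reduced powers; any other
  reduced word is conjugate to a shorter one.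
\<close>

lemma reduce_power_nonempty_aux:
  assumes "reduced_word v" "v \<noteq> []" "n > 0"
  shows "reduce (concat (replicate n v)) \<noteq> []"
  using assms
proof (induction v rule: length_induct)
  case (1 v)
  show ?case
  proof (cases "hd v = inv_letter (last v)")
    case False
    have "reduced_word (concat (replicate m v)) \<and>
          (concat (replicate m v) \<noteq> [] \<longrightarrow> hd (concat (replicate m v)) = hd v)" for m
      using 1 False by (induction m) (auto simp: reduced_word_append)
    thus ?thesis
      using 1 by (auto simp: reduce_reduced gr0_conv_Suc)
  next
    case True
    obtain a w where v: "v = a # w"
      using 1 by (cases v) auto
    with True have "w \<noteq> []" by auto
    then obtain m b where "w = m @ [b]"
      by (metis rev_exhaust)
    with v True have v: "v = a # m @ [inv_letter a]"
      by auto
    have "m \<noteq> []" "reduced_word m"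
      using 1(2) v by (auto simp: reduced_word_Cons reduced_word_append)
    hence "reduce (concat (replicate n m)) \<noteq> []"
      using 1 v by simp
    thus ?thesis
      using reduce_conjugate_Nil[of "[a]"] by (auto simp: v reduce_power_conjugate)
  qed
qed

lemma reduce_power_nonempty:
  assumes "reduce v \<noteq> []" "n > 0"
  shows "reduce (concat (replicate n v)) \<noteq> []"
proof -
  have "reduce (concat (replicate m v)) = reduce (concat (replicate m (reduce v)))" for m
    by (induction m) (auto intro!: reduce_cong)
  thus ?thesis
    using reduce_power_nonempty_aux[OF reduced_reduce assms] by simp
qed

section \<open>Subnormal closures\<close>

context group
begin

lemma normal_restrict_iff:
  assumes "subgroup P G"
  shows "M \<lhd> G\<lparr>carrier := P\<rparr> \<longleftrightarrow>
    subgroup M G \<and> M \<subseteq> P \<and> (\<forall>x\<in>P. \<forall>m\<in>M. x \<otimes> m \<otimes> inv x \<in> M)"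
proof -
  interpret P: group "G\<lparr>carrier := P\<rparr>"
    using assms by (rule subgroup_imp_group)
  have "subgroup M (G\<lparr>carrier := P\<rparr>) \<longleftrightarrow> subgroup M G \<and> M \<subseteq> P"
    using incl_subgroup[OF assms] subgroup_incl[OF _ assms]
      subgroup.subset[of M "G\<lparr>carrier := P\<rparr>"] by auto
  moreover have "inv\<^bsub>G\<lparr>carrier := P\<rparr>\<^esub> x = inv x" if "x \<in> P" for x
    using m_inv_consistent[OF assms that] .
  ultimately show ?thesis
    by (simp add: P.normal_inv_iff conj_assoc)
qed

lemma subnormal_closure_subgroup:
  assumes "g \<in> carrier G"
  shows "subgroup (subnormal_closure G g i) G \<and> g \<in> subnormal_closure G g i"
proof (induction i)
  case 0
  show ?case using assms by (simp add: subgroup_self)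
next
  case (Suc i)
  interpret N: group "G\<lparr>carrier := subnormal_closure G g i\<rparr>"
    using Suc by (intro subgroup_imp_group) auto
  show ?case
    using N.normal_closure_normal[of g] Suc normal_restrict_iff by auto
qed

lemma subnormal_closure_antimono:
  assumes "g \<in> carrier G" "i \<le> j"
  shows "subnormal_closure G g j \<subseteq> subnormal_closure G g i"
  using assms(2)
proof (induction j rule: dec_induct)
  case (step j)
  have sub: "subgroup (subnormal_closure G g j) G" "g \<in> subnormal_closure G g j"
    using subnormal_closure_subgroup[OF assms(1)] by auto
  then interpret N: group "G\<lparr>carrier := subnormal_closure G g j\<rparr>"
    by (intro subgroup_imp_group)
  show ?case
    using N.normal_closure_normal(1)[of g] sub step normal_restrict_iff by auto
qed auto

text \<open>
  Intersecting \<open>M\<close> with the closure at stage \<open>i\<close> gives a normal subgroup of that closure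
  which contains \<open>g\<close>. Thus subnormal closures are bounded above by any chain of relatively normal
  subgroups containing \<open>g\<close>.
\<close>

lemma subnormal_closure_Suc_subset:
  assumes "subgroup P G" "M \<lhd> G\<lparr>carrier := P\<rparr>" "g \<in> M" "subnormal_closure G g i \<subseteq> P"
  shows "subnormal_closure G g (Suc i) \<subseteq> M"
proof -
  let ?N = "subnormal_closure G g i"
  have M: "subgroup M G" "M \<subseteq> P" "\<And>x m. x \<in> P \<Longrightarrow> m \<in> M \<Longrightarrow> x \<otimes> m \<otimes> inv x \<in> M"
    using assms normal_restrict_iff by auto
  have "g \<in> carrier G"
    using M assms subgroup.mem_carrier by metis
  hence N: "subgroup ?N G" "g \<in> ?N"
    using subnormal_closure_subgroup by auto
  have "?N \<inter> M \<lhd> G\<lparr>carrier := ?N\<rparr>"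
    using N M assms(4)
    by (auto simp: normal_restrict_iff subgroups_Inter_pair subgroup.m_closed subgroup.m_inv_closed)
  thus ?thesis
    using normal_closure_least[of "?N \<inter> M" "G\<lparr>carrier := ?N\<rparr>" g] N assms by auto
qed

lemma subnormal_of_normal:
  assumes "N \<lhd> G" "l \<ge> 1"
  shows "subnormal l N G"
proof -
  have N: "subgroup N G"
    using assms normal_imp_subgroup by blast
  hence "N \<lhd> G\<lparr>carrier := N\<rparr>"
    by (auto simp: normal_restrict_iff subgroup.m_closed subgroup.m_inv_closed)
  thus ?thesis
    using assms unfolding subnormal_def
    by (intro exI[of _ "\<lambda>i. if i = 0 then carrier G else N"]) auto
qed

end

section \<open>Paths in Schreier graphs\<close>

locale group_with_free_basis = group G for G (structure) +
  fixes B
  assumes free_basis: "free_basis G B"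
begin

abbreviation wds :: "(bool \<times> 'a) list set" where "wds \<equiv> lists (UNIV \<times> B)"

abbreviation val where "val \<equiv> word_value G"

definition letter_value :: "bool \<times> 'a \<Rightarrow> 'a" where
  "letter_value a = (if fst a then snd a else inv (snd a))"

lemma basis_carrier: "B \<subseteq> carrier G"
  using free_basis by (simp add: free_basis_def)

lemma letter_value_closed [simp]: "a \<in> UNIV \<times> B \<Longrightarrow> letter_value a \<in> carrier G"
  using basis_carrier by (auto simp: letter_value_def)

lemma letter_value_inv [simp]:
  "a \<in> UNIV \<times> B \<Longrightarrow> letter_value (inv_letter a) = inv (letter_value a)"
  using basis_carrier by (auto simp: letter_value_def)

lemma val_simps [simp]: "val [] = \<one>" "val (a # w) = letter_value a \<otimes> val w"
  by (auto simp: word_value_def letter_value_def split: prod.splits)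

lemma val_closed [simp]: "w \<in> wds \<Longrightarrow> val w \<in> carrier G"
  by (induction w rule: lists.induct) auto

lemma val_append: "u \<in> wds \<Longrightarrow> v \<in> wds \<Longrightarrow> val (u @ v) = val u \<otimes> val v"
  by (induction u rule: lists.induct) (auto simp: m_assoc)

lemma val_inv_word: "w \<in> wds \<Longrightarrow> val (inv_word w) = inv (val w)"
proof (induction w rule: lists.induct)
  case (Cons a w)
  have "[inv_letter a] \<in> wds"
    using Cons by (auto simp: inv_letter_def)
  thus ?case
    using Cons by (simp add: val_append inv_word_in_lists inv_mult_group)
qed auto

lemma val_power: "w \<in> wds \<Longrightarrow> val (concat (replicate n w)) = val w [^] n"
proof (induction n)
  case (Suc n)
  have "concat (replicate n w) \<in> wds"
    using Suc.prems by (induction n) auto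
  thus ?case
    using Suc nat_pow_Suc2[of "val w" n] by (simp add: val_append)
qed auto

lemma val_reduce: "w \<in> wds \<Longrightarrow> val (reduce w) = val w"
proof (rule reduce_invariant)
  fix u v and a :: "bool \<times> 'a" assume *: "u \<in> wds" "a \<in> UNIV \<times> B" "v \<in> wds"
  have "inv_letter a \<in> UNIV \<times> B"
    using * by (simp add: inv_letter_in_lists)
  hence "val (u @ a # inv_letter a # v) = val u \<otimes> (letter_value a \<otimes> (inv (letter_value a) \<otimes> val v))"
    using * by (subst val_append) auto
  also have "letter_value a \<otimes> (inv (letter_value a) \<otimes> val v) = val v"
    using * by (simp add: m_assoc[symmetric])
  finally show "val (u @ a # inv_letter a # v) = val (u @ v)"
    using * by (simp add: val_append)
qed

lemma reduce_eq_if_val_eq: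
  assumes "u \<in> wds" "v \<in> wds" "val u = val v"
  shows "reduce u = reduce v"
proof (rule inj_onD)
  show "inj_on val {w \<in> wds. reduced_word w}"
    using free_basis by (simp add: free_basis_def bij_betw_def)
qed (use assms in \<open>auto simp: val_reduce reduce_in_lists reduced_reduce\<close>)

lemma obtain_word:
  assumes "x \<in> carrier G"
  obtains w where "w \<in> wds" "reduced_word w" "val w = x"
proof -
  have "x \<in> val ` {w \<in> wds. reduced_word w}"
    using assms free_basis by (simp add: free_basis_def bij_betw_def)
  thus ?thesis using that by blast
qed

text \<open>
  The edge path in the Schreier graph of \<open>M\<close> that starts at the vertex \<open>M f\<close> and is labelled by the
  given word. The edge \<open>(v, x)\<close> leads from the coset \<open>v\<close> to \<open>v x\<close>; a letter \<open>x\<^sup>-\<^sup>1\<close> traverses an edge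
  backwards, and this edge is named after the vertex at which the path arrives.
\<close>

primrec path :: "'a set \<Rightarrow> 'a \<Rightarrow> (bool \<times> 'a) list \<Rightarrow> (bool \<times> ('a set \<times> 'a)) list" where
  "path M f [] = []"
| "path M f (a # w) =
     (fst a, (M #> (if fst a then f else f \<otimes> inv (snd a)), snd a)) # path M (f \<otimes> letter_value a) w"

lemma path_append:
  "\<lbrakk>f \<in> carrier G; u \<in> wds; v \<in> wds\<rbrakk> \<Longrightarrow> path M f (u @ v) = path M f u @ path M (f \<otimes> val u) v"
  by (induction u arbitrary: f) (auto simp: m_assoc)

lemma path_cancel:
  assumes "f \<in> carrier G" "a \<in> UNIV \<times> B"
  shows "path M f (a # inv_letter a # v) =
         path M f [a] @ inv_word (path M f [a]) @ path M f v"
  using assms basis_carrier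
  by (cases a) (auto simp: inv_letter_def letter_value_def m_assoc)

lemma path_inv_word:
  assumes "f \<in> carrier G" "w \<in> wds"
  shows "path M (f \<otimes> val w) (inv_word w) = inv_word (path M f w)"
  using assms(2,1)
proof (induction w arbitrary: f rule: lists.induct)
  case (Cons a w)
  have ia: "inv_letter a \<in> UNIV \<times> B" "inv_word w \<in> wds"
    using Cons by (auto simp: inv_letter_in_lists inv_word_in_lists)
  have "path M (f \<otimes> val (a # w)) (inv_word (a # w)) =
        path M (f \<otimes> letter_value a \<otimes> val w) (inv_word w) @
        path M (f \<otimes> letter_value a) [inv_letter a]"
    using Cons ia by (simp add: path_append m_assoc val_inv_word del: path.simps)
  also have "path M (f \<otimes> letter_value a) [inv_letter a] = inv_word (path M f [a])"
    using path_cancel[of f a M "[]"] Cons by simp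
  finally show ?case
    using Cons by simp
qed auto

text \<open>
  Edges remember their labels, so adjacent inverse edges can only come from adjacent
  inverse letters.
\<close>

lemma reduced_path: "reduced_word w \<Longrightarrow> reduced_word (path M f w)"
proof (induction w arbitrary: f)
  case (Cons a w)
  thus ?case
    by (cases w) (auto simp: reduced_word_Cons eq_inv_letter_iff)
qed auto

lemma reduce_path:
  assumes "f \<in> carrier G" "w \<in> wds"
  shows "reduce (path M f w) = path M f (reduce w)"
proof -
  have "reduce (path M f (reduce w)) = reduce (path M f w)"
  proof (rule reduce_map_reduce[OF _ assms(2)])
    fix u v and a :: "bool \<times> 'a" assume *: "u \<in> wds" "a \<in> UNIV \<times> B" "v \<in> wds"
    show "\<exists>u' c v'. path M f (u @ a # inv_letter a # v) = u' @ c @ inv_word c @ v' \<and>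
             path M f (u @ v) = u' @ v'"
      using * assms
      by (intro exI[of _ "path M f u"] exI[of _ "path M (f \<otimes> val u) v"]
          exI[of _ "path M (f \<otimes> val u) [a]"])
        (simp add: path_append inv_letter_in_lists path_cancel del: path.simps)
  qed
  thus ?thesis
    by (simp add: reduce_reduced reduced_path reduced_reduce)
qed

lemma path_translate:
  assumes "subgroup M G" "m \<in> M" "f \<in> carrier G" "w \<in> wds"
  shows "path M (m \<otimes> f) w = path M f w"
  using assms(4,3)
proof (induction w arbitrary: f rule: lists.induct)
  case (Cons a w)
  have m: "m \<in> carrier G"
    using assms subgroup.mem_carrier by metis
  have "M #> (m \<otimes> x) = M #> x" if "x \<in> carrier G" for x
    using assms that m coset_mult_assoc[of M m x] coset_join2[of m M] subgroup.subset by metis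
  moreover have "inv (snd a) \<in> carrier G"
    using Cons basis_carrier by auto
  ultimately show ?case
    using Cons m by (auto simp: m_assoc)
qed auto


text \<open>
  The cosets along the path of \<open>w\<close> from the translate \<open>x f\<close> are the translates by \<open>x\<close> of finitely many
  positions \<open>Y\<close> that do not depend on \<open>x\<close>.
\<close>

lemma path_vertices:
  assumes "f \<in> carrier G" "w \<in> wds"
  obtains Y where "finite Y" "Y \<subseteq> carrier G"
    "\<And>x e. x \<in> carrier G \<Longrightarrow> e \<in> set (path M (x \<otimes> f) w) \<Longrightarrow> \<exists>y\<in>Y. fst (snd e) = M #> (x \<otimes> y)"
proof -
  have "\<exists>Y. finite Y \<and> Y \<subseteq> carrier G \<and>
    (\<forall>x\<in>carrier G. \<forall>e\<in>set (path M (x \<otimes> f) w). \<exists>y\<in>Y. fst (snd e) = M #> (x \<otimes> y))"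
    using assms(2,1)
  proof (induction w arbitrary: f rule: lists.induct)
    case Nil
    show ?case by (intro exI[of _ "{}"]) auto
  next
    case (Cons a w)
    have "f \<otimes> letter_value a \<in> carrier G"
      using Cons by simp
    from Cons.IH[OF this] obtain Y where Y: "finite Y" "Y \<subseteq> carrier G"
      "\<And>x e. x \<in> carrier G \<Longrightarrow> e \<in> set (path M (x \<otimes> (f \<otimes> letter_value a)) w) \<Longrightarrow>
         \<exists>y\<in>Y. fst (snd e) = M #> (x \<otimes> y)"
      by blast
    define y where "y = (if fst a then f else f \<otimes> inv (snd a))"
    have a: "snd a \<in> carrier G" "letter_value a \<in> carrier G"
      using Cons basis_carrier by auto
    hence "y \<in> carrier G"
      using Cons.prems by (simp add: y_def)
    moreover have "\<exists>y'\<in>insert y Y. fst (snd e) = M #> (x \<otimes> y')"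
      if "x \<in> carrier G" "e \<in> set (path M (x \<otimes> f) (a # w))" for x e
      using Y(3)[of x e] that a Cons.prems by (auto simp: y_def m_assoc split: if_splits)
    ultimately show ?case
      using Y(1,2) by (intro exI[of _ "insert y Y"]) auto
  qed
  thus ?thesis using that by blast
qed

text \<open>
  The translates of a vertex by the powers of \<open>h\<close> are pairwise distinct, which makes it possible to
  move a finite path off any finite set of edges.
\<close>

lemma inj_power_coset:
  assumes "subgroup M G" "h \<in> carrier G" "y \<in> carrier G" "\<And>n. n > 0 \<Longrightarrow> h [^] (n::nat) \<notin> M"
  shows "inj (\<lambda>n::nat. M #> (h [^] n \<otimes> y))"
proof -
  have no_collision: False if "n < m" "M #> (h [^] n \<otimes> y) = M #> (h [^] m \<otimes> y)" for n m :: nat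
  proof -
    have "h [^] m \<otimes> y \<in> M #> (h [^] n \<otimes> y)"
      using that assms rcos_self[of "h [^] m \<otimes> y" M] by simp
    then obtain a where a: "a \<in> M" "h [^] m \<otimes> y = a \<otimes> (h [^] n \<otimes> y)"
      by (auto simp: r_coset_def)
    have ac: "a \<in> carrier G"
      using a assms subgroup.mem_carrier by metis
    have "h [^] (m - n) \<otimes> h [^] n \<otimes> y = a \<otimes> h [^] n \<otimes> y"
      using a ac that assms by (simp add: nat_pow_mult m_assoc)
    hence "h [^] (m - n) = a"
      using ac assms by simp
    thus False
      using assms(4)[of "m - n"] a that by simp
  qed
  show ?thesis
  proof (rule injI)
    fix n m :: nat assume "M #> (h [^] n \<otimes> y) = M #> (h [^] m \<otimes> y)"
    thus "n = m"
      using no_collision[of n m] no_collision[of m n] by (cases n m rule: linorder_cases) auto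
  qed
qed

section \<open>Deleting edges\<close>

text \<open>
  The image of a path in the free group on the edges outside \<open>S\<close>. On words with values in \<open>M\<close> this
  induces a homomorphism from \<open>M\<close> to that free group, and \<open>deletion_kernel\<close> is its kernel.
\<close>

definition deleted_path where
  "deleted_path M S w = filter (\<lambda>e. snd e \<notin> S) (path M \<one> w)"

definition deletion_kernel where
  "deletion_kernel M S = {val w |w. w \<in> wds \<and> val w \<in> M \<and> reduce (deleted_path M S w) = []}"

lemma deleted_path_Nil [simp]: "deleted_path M S [] = []"
  by (simp add: deleted_path_def)

text \<open>
  A word with value in \<open>M\<close> labels a closed path, so the second word is read from the base vertex again.
\<close>

lemma deleted_path_append:
  assumes "subgroup M G" "u \<in> wds" "v \<in> wds" "val u \<in> M"
  shows "deleted_path M S (u @ v) = deleted_path M S u @ deleted_path M S v"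
  using assms path_translate[of M "val u" \<one> v] by (simp add: deleted_path_def path_append)

lemma val_in_deletion_kernel_iff:
  assumes "w \<in> wds" "val w \<in> M"
  shows "val w \<in> deletion_kernel M S \<longleftrightarrow> reduce (deleted_path M S w) = []"
proof -
  have same: "reduce (deleted_path M S u) = reduce (deleted_path M S w)"
    if "u \<in> wds" "val u = val w" for u
    unfolding deleted_path_def
    using that assms reduce_eq_if_val_eq[of u w]
    by (intro reduce_filter_cong) (simp add: reduce_path)
  show ?thesis
  proof
    assume "val w \<in> deletion_kernel M S"
    then obtain u where u: "u \<in> wds" "val u = val w" "reduce (deleted_path M S u) = []"
      unfolding deletion_kernel_def by force
    show "reduce (deleted_path M S w) = []"
      using same[OF u(1,2)] u(3) by simp
  next
    assume "reduce (deleted_path M S w) = []"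
    thus "val w \<in> deletion_kernel M S"
      unfolding deletion_kernel_def using assms by blast
  qed
qed

lemma deletion_kernel_normal:
  assumes M: "subgroup M G"
  shows "deletion_kernel M S \<lhd> G\<lparr>carrier := M\<rparr>"
proof -
  let ?K = "deletion_kernel M S" and ?d = "deleted_path M S"
  have K_word: "\<exists>w\<in>wds. val w = x \<and> x \<in> M \<and> reduce (?d w) = []" if "x \<in> ?K" for x
    using that by (auto simp: deletion_kernel_def)
  have d_inv: "reduce (?d w @ ?d (inv_word w)) = []" if "w \<in> wds" "val w \<in> M" for w
  proof -
    have "w @ inv_word w \<in> wds"
      using that by (simp add: inv_word_in_lists)
    moreover have "val (w @ inv_word w) = \<one>"
      using that by (simp add: val_append val_inv_word inv_word_in_lists)
    ultimately have "reduce (?d (w @ inv_word w)) = reduce (?d [])"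
      using val_in_deletion_kernel_iff[of "[]" M S] val_in_deletion_kernel_iff[of "w @ inv_word w" M S]
        subgroup.one_closed[OF M] by simp
    thus ?thesis
      using that M by (simp add: deleted_path_append inv_word_in_lists)
  qed
  have conj: "x \<otimes> m \<otimes> inv x \<in> ?K" if x: "x \<in> M" and m: "m \<in> ?K" for x m
  proof -
    obtain u where u: "u \<in> wds" "val u = x"
      using obtain_word[of x] x M subgroup.mem_carrier by metis
    obtain w where w: "w \<in> wds" "val w = m" "m \<in> M" "reduce (?d w) = []"
      using K_word m by blast
    have xm: "x \<otimes> m \<in> M" "inv x \<in> M" "x \<otimes> m \<otimes> inv x \<in> M"
      using x w M by (simp_all add: subgroup.m_closed subgroup.m_inv_closed)
    have eq: "?d ((u @ w) @ inv_word u) = ?d u @ ?d w @ ?d (inv_word u)"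
      using u w x xm M by (simp add: deleted_path_append val_append inv_word_in_lists del: append_assoc)
    have "reduce (?d u @ ?d w @ ?d (inv_word u)) = reduce (?d u @ [] @ ?d (inv_word u))"
      using w by (intro reduce_cong) auto
    hence "reduce (?d ((u @ w) @ inv_word u)) = []"
      using d_inv[of u] u x by (simp add: eq del: append_assoc)
    moreover have "val ((u @ w) @ inv_word u) = x \<otimes> m \<otimes> inv x"
      using u w by (simp add: val_append val_inv_word inv_word_in_lists del: append_assoc)
    ultimately show ?thesis
      using u w xm val_in_deletion_kernel_iff[of "(u @ w) @ inv_word u" M S]
      by (simp add: inv_word_in_lists)
  qed
  have "subgroup ?K G"
  proof (rule subgroupI)
    show "?K \<subseteq> carrier G"
      by (auto simp: deletion_kernel_def intro!: val_closed)
    have "\<one> \<in> ?K"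
      using val_in_deletion_kernel_iff[of "[]" M S] subgroup.one_closed[OF M]
      by simp
    thus "?K \<noteq> {}" by blast
  next
    fix x assume "x \<in> ?K"
    then obtain w where w: "w \<in> wds" "val w = x" "x \<in> M" "reduce (?d w) = []"
      using K_word by blast
    have "reduce (?d w @ ?d (inv_word w)) = reduce ([] @ ?d (inv_word w))"
      using w by (intro reduce_cong) auto
    hence "reduce (?d (inv_word w)) = []"
      using d_inv[of w] w by simp
    thus "inv x \<in> ?K"
      using w M val_in_deletion_kernel_iff[of "inv_word w" M S]
      by (simp add: inv_word_in_lists val_inv_word subgroup.m_inv_closed)
  next
    fix x y assume "x \<in> ?K" "y \<in> ?K"
    then obtain u w where u: "u \<in> wds" "val u = x" "x \<in> M" "reduce (?d u) = []"
      and w: "w \<in> wds" "val w = y" "y \<in> M" "reduce (?d w) = []"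
      using K_word by meson
    have "reduce (?d u @ ?d w) = reduce ([] @ [])"
      using u w by (intro reduce_cong) auto
    thus "x \<otimes> y \<in> ?K"
      using u w M val_in_deletion_kernel_iff[of "u @ w" M S]
      by (simp add: val_append deleted_path_append subgroup.m_closed)
  qed
  thus ?thesis
    using M conj by (auto simp: normal_restrict_iff deletion_kernel_def)
qed

text \<open>
  The inductive step: \<open>M'\<close> is the kernel of deleting the edges on the path of \<open>g\<close>, and \<open>n\<close> is chosen so
  that the translate by \<open>h\<^sup>n\<close> of the path of \<open>k\<close> is not affected by the deletion.
\<close>

lemma conjugate_avoiding_kernel:
  assumes M: "subgroup M G" and g: "g \<in> M" and k: "k \<in> M" "k \<noteq> \<one>"
    and h: "h \<in> carrier G" "\<And>n. n > 0 \<Longrightarrow> h [^] (n::nat) \<notin> M"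
    and conj: "\<And>n. h [^] (n::nat) \<otimes> k \<otimes> inv (h [^] n) \<in> M"
  obtains n :: nat and M' where "M' \<lhd> G\<lparr>carrier := M\<rparr>" "g \<in> M'"
    "\<And>j. j > 0 \<Longrightarrow> (h [^] n \<otimes> k \<otimes> inv (h [^] n)) [^] (j::nat) \<notin> M'"
proof -
  have gk: "g \<in> carrier G" "k \<in> carrier G"
    using g k M subgroup.mem_carrier by metis+
  obtain u where u: "u \<in> wds" "val u = g"
    using obtain_word gk by metis
  obtain v where v: "v \<in> wds" "reduced_word v" "val v = k"
    using obtain_word gk by metis
  define S where "S = snd ` set (path M \<one> u)"
  obtain Y where Y: "finite Y" "Y \<subseteq> carrier G"
    "\<And>x e. x \<in> carrier G \<Longrightarrow> e \<in> set (path M (x \<otimes> \<one>) v) \<Longrightarrow> \<exists>y\<in>Y. fst (snd e) = M #> (x \<otimes> y)"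
    using path_vertices[OF one_closed v(1)] by metis
  have "finite (\<Union>y\<in>Y. (\<lambda>n::nat. M #> (h [^] n \<otimes> y)) -` (fst ` S))"
    using Y M h by (intro finite_UN_I finite_vimageI inj_power_coset) (auto simp: S_def)
  then obtain n where n: "n \<notin> (\<Union>y\<in>Y. (\<lambda>n::nat. M #> (h [^] n \<otimes> y)) -` (fst ` S))"
    using ex_new_if_finite infinite_UNIV_nat by blast
  define x where "x = h [^] n"
  have x: "x \<in> carrier G" "x \<otimes> k \<otimes> inv x \<in> M"
    using h conj by (simp_all add: x_def)
  have off: "snd e \<notin> S" if "e \<in> set (path M x v)" for e
    using Y(3)[of x e] that x n by (force simp: x_def)
  obtain p where p: "p \<in> wds" "val p = x"
    using obtain_word x by metis
  define q where "q = p @ v @ inv_word p"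
  have q: "q \<in> wds" "val q = x \<otimes> k \<otimes> inv x"
    using p v x gk by (simp_all add: q_def inv_word_in_lists val_append val_inv_word m_assoc)
  \<comment> \<open>The path of \<open>h\<^sup>n k h\<^sup>-\<^sup>n\<close> runs along \<open>p\<close>, then along the translated path of \<open>k\<close>, and back along \<open>p\<close>.\<close>
  define C where "C = filter (\<lambda>e. snd e \<notin> S) (path M \<one> p)"
  have "path M (x \<otimes> k) (inv_word p) = path M (x \<otimes> k \<otimes> inv x \<otimes> x) (inv_word p)"
    using x gk by (simp add: m_assoc)
  also have "\<dots> = path M x (inv_word p)"
    using x M p by (intro path_translate) (auto simp: inv_word_in_lists)
  also have "\<dots> = inv_word (path M \<one> p)"
    using path_inv_word[of \<one> p M] p x by simp
  finally have "deleted_path M S q = C @ filter (\<lambda>e. snd e \<notin> S) (path M x v) @ inv_word C"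
    using p v x by (simp add: deleted_path_def q_def path_append inv_word_in_lists C_def filter_inv_word)
  also have "filter (\<lambda>e. snd e \<notin> S) (path M x v) = path M x v"
    using off by (simp add: filter_True)
  finally have dq: "deleted_path M S q = C @ path M x v @ inv_word C" .
  have "v \<noteq> []"
    using v k by auto
  hence "reduce (path M x v) \<noteq> []"
    using reduced_path[OF v(2), of M x] by (cases v) (simp_all add: reduce_reduced del: reduce_simps(2))
  hence "reduce (deleted_path M S q) \<noteq> []"
    using reduce_conjugate_Nil unfolding dq by blast
  hence "reduce (concat (replicate j (deleted_path M S q))) \<noteq> []" if "j > 0" for j
    using that by (rule reduce_power_nonempty)
  moreover have qj: "concat (replicate j q) \<in> wds" for j
    using q by (induction j) auto
  moreover have "deleted_path M S (concat (replicate j q)) = concat (replicate j (deleted_path M S q))"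
    for j
    using q x M by (induction j) (simp_all add: deleted_path_append qj)
  moreover have "val (concat (replicate j q)) \<in> M" for j
    using q x M by (induction j) (simp_all add: val_append qj subgroup.one_closed subgroup.m_closed)
  ultimately have "val (concat (replicate j q)) \<notin> deletion_kernel M S" if "j > 0" for j
    using that by (simp add: val_in_deletion_kernel_iff)
  hence "(x \<otimes> k \<otimes> inv x) [^] j \<notin> deletion_kernel M S" if "j > 0" for j :: nat
    using that q by (metis val_power)
  moreover have "deleted_path M S u = []"
    by (auto simp: deleted_path_def S_def filter_empty_conv)
  hence "g \<in> deletion_kernel M S"
    using val_in_deletion_kernel_iff[of u M S] u g by simp
  ultimately show ?thesis
    using that[of "deletion_kernel M S" n] deletion_kernel_normal[OF M] by (simp add: x_def)
qed

section \<open>Exponent sums\<close>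

definition exponent_sum :: "'a \<Rightarrow> (bool \<times> 'a) list \<Rightarrow> int" where
  "exponent_sum b w = (\<Sum>a\<leftarrow>w. if snd a = b then if fst a then 1 else -1 else 0)"

lemma exponent_sum_append [simp]:
  "exponent_sum b (u @ v) = exponent_sum b u + exponent_sum b v"
  by (simp add: exponent_sum_def)

lemma exponent_sum_inv_word [simp]: "exponent_sum b (inv_word w) = - exponent_sum b w"
  by (induction w) (auto simp: exponent_sum_def)

lemma exponent_sum_cong:
  assumes "u \<in> wds" "v \<in> wds" "val u = val v"
  shows "exponent_sum b u = exponent_sum b v"
proof -
  have "exponent_sum b (reduce w) = exponent_sum b w" if "w \<in> wds" for w
    by (rule reduce_invariant[OF _ that]) (auto simp: exponent_sum_def)
  thus ?thesis
    using assms reduce_eq_if_val_eq by metis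
qed

text \<open>
  The pair of exponent sums of \<open>g\<close> in \<open>a\<close> and \<open>b\<close> is annihilated by some nonzero pair of integer
  weights \<open>c\<close>, \<open>d\<close>; the corresponding combination of exponent sums is a homomorphism to the
  integers that kills \<open>g\<close> but does not kill both \<open>a\<close> and \<open>b\<close>.
\<close>

lemma exists_infinite_cyclic_quotient:
  assumes ab: "a \<in> B" "b \<in> B" "a \<noteq> b" and g: "g \<in> carrier G"
  obtains M h where "M \<lhd> G" "g \<in> M" "h \<in> carrier G" "\<And>n. n > 0 \<Longrightarrow> h [^] (n::nat) \<notin> M"
proof -
  obtain u where u: "u \<in> wds" "val u = g"
    using obtain_word g by metis
  obtain c d :: int where cd: "c * exponent_sum a u + d * exponent_sum b u = 0" "c \<noteq> 0 \<or> d \<noteq> 0"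
  proof (cases "exponent_sum a u = 0")
    case True
    thus thesis using that[of 1 0] by simp
  next
    case False
    thus thesis using that[of "exponent_sum b u" "- exponent_sum a u"] by simp
  qed
  define \<phi> where "\<phi> w = c * exponent_sum a w + d * exponent_sum b w" for w
  define M where "M = {val w |w. w \<in> wds \<and> \<phi> w = 0}"
  have M_iff: "val w \<in> M \<longleftrightarrow> \<phi> w = 0" if "w \<in> wds" for w
    using that exponent_sum_cong unfolding M_def \<phi>_def by (smt (verit) mem_Collect_eq)
  have \<phi>_simps: "\<phi> (v @ w) = \<phi> v + \<phi> w" "\<phi> (inv_word v) = - \<phi> v" for v w
    by (simp_all add: \<phi>_def algebra_simps)
  have "subgroup M G"
  proof (rule subgroupI)
    show "M \<subseteq> carrier G"
      by (auto simp: M_def intro!: val_closed)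
    have "val [] \<in> M"
      by (subst M_iff) (auto simp: \<phi>_def exponent_sum_def)
    thus "M \<noteq> {}" by blast
  next
    fix x assume "x \<in> M"
    then obtain w where "w \<in> wds" "\<phi> w = 0" "x = val w"
      by (auto simp: M_def)
    thus "inv x \<in> M"
      using M_iff[of "inv_word w"] by (simp add: inv_word_in_lists val_inv_word \<phi>_simps)
  next
    fix x y assume "x \<in> M" "y \<in> M"
    then obtain v w where "v \<in> wds" "\<phi> v = 0" "x = val v" "w \<in> wds" "\<phi> w = 0" "y = val w"
      by (auto simp: M_def)
    thus "x \<otimes> y \<in> M"
      using M_iff[of "v @ w"] by (simp add: val_append \<phi>_simps)
  qed
  moreover have "x \<otimes> y \<otimes> inv x \<in> M" if x: "x \<in> carrier G" and y: "y \<in> M" for x y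
  proof -
    obtain v where v: "v \<in> wds" "val v = x"
      using obtain_word[OF x] by metis
    obtain w where "w \<in> wds" "\<phi> w = 0" "y = val w"
      using y by (auto simp: M_def)
    thus ?thesis
      using M_iff[of "v @ w @ inv_word v"] v x
      by (simp add: inv_word_in_lists val_append val_inv_word \<phi>_simps m_assoc)
  qed
  ultimately have "M \<lhd> G"
    by (rule normal_invI)
  moreover have "g \<in> M"
    using M_iff u cd by (auto simp: \<phi>_def)
  moreover obtain z where z: "z \<in> B" "\<phi> [(True, z)] \<noteq> 0"
    using cd(2) ab by (auto simp: \<phi>_def exponent_sum_def)
  have "z [^] n \<notin> M" if "n > 0" for n :: nat
  proof -
    have "\<phi> (concat (replicate n [(True, z)])) = int n * \<phi> [(True, z)]"
    proof (induction n)
      case 0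
      show ?case by (simp add: \<phi>_def exponent_sum_def)
    next
      case (Suc n)
      have "\<phi> (concat (replicate (Suc n) [(True, z)])) =
            \<phi> ([(True, z)] @ concat (replicate n [(True, z)]))"
        by simp
      also have "\<dots> = \<phi> [(True, z)] + int n * \<phi> [(True, z)]"
        using Suc by (simp only: \<phi>_simps(1))
      finally show ?case
        by (simp add: algebra_simps)
    qed
    moreover have "concat (replicate n [(True, z)]) \<in> wds" "[(True, z)] \<in> wds"
      using z by auto
    moreover have "val [(True, z)] = z"
      using z basis_carrier by (auto simp: letter_value_def)
    ultimately show ?thesis
      using that z subsetD[OF basis_carrier z(1)] val_power[of "[(True, z)]" n] M_iff[of "concat (replicate n [(True, z)])"] by simp
  qed
  ultimately show ?thesis
    using that[of M z] z basis_carrier by blast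
qed

lemma two_basis_elements:
  assumes "\<not> cyclic_group G"
  obtains a b where "a \<in> B" "b \<in> B" "a \<noteq> b"
proof (rule ccontr)
  assume neg: "\<not> thesis"
  have all_eq: "\<forall>x\<in>B. \<forall>y\<in>B. x = y"
    using that neg by blast
  obtain a where a: "a \<in> carrier G" "B \<subseteq> {a}"
  proof (cases "B = {}")
    case True
    thus thesis using that[of \<one>] by simp
  next
    case False
    then obtain a where "a \<in> B" by blast
    moreover have "B \<subseteq> {a}"
      using all_eq \<open>a \<in> B\<close> by blast
    ultimately show thesis
      using that[of a] basis_carrier by blast
  qed
  have vals: "val w \<in> range (\<lambda>n::int. a [^] n)" if "w \<in> wds" for w
    using that
  proof (induction w rule: lists.induct)
    case Nil
    show ?case by (auto intro: range_eqI[of _ _ 0])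
  next
    case (Cons l w)
    then obtain n :: int where n: "val w = a [^] n"
      by auto
    have "letter_value l = a [^] (if fst l then 1 else -1 :: int)"
      using Cons a by (auto simp: letter_value_def int_pow_neg)
    hence "val (l # w) = a [^] ((if fst l then 1 else -1) + n)"
      using a n by (simp add: int_pow_mult)
    thus ?case by blast
  qed
  have "carrier G = range (\<lambda>n::int. a [^] n)"
  proof
    show "carrier G \<subseteq> range (\<lambda>n::int. a [^] n)"
    proof
      fix x assume "x \<in> carrier G"
      then obtain w where w: "w \<in> wds" "val w = x"
        by (rule obtain_word)
      show "x \<in> range (\<lambda>n::int. a [^] n)"
        using vals[OF w(1)] w(2) by simp
    qed
    show "range (\<lambda>n::int. a [^] n) \<subseteq> carrier G"
      using a by auto
  qed
  thus False
    using assms a cyclic_group by blast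
qed

end

section \<open>The descending chain\<close>

text \<open>
  The two descending chains are built in parallel. In the induction \<open>P\<close> and \<open>M\<close> are consecutive terms of
  the chain through \<open>g\<close>, and \<open>h\<close> witnesses that the \<open>i\<close>-th term of the subnormal chain of \<open>K\<close> meets \<open>P\<close>
  in an element of infinite order modulo \<open>M\<close>.
\<close>

lemma (in group_with_free_basis) subnormal_subgroup_trivial:
  assumes "\<not> cyclic_group G" and g: "g \<in> carrier G"
    and "subnormal l K G" and K: "K \<subseteq> subnormal_closure G g (Suc l)"
  shows "K = {\<one>}"
proof (rule ccontr)
  assume nontrivial: "K \<noteq> {\<one>}"
  let ?N = "subnormal_closure G g"
  obtain H where H: "H 0 = carrier G" "H l = K" "\<And>i. i < l \<Longrightarrow> H (Suc i) \<lhd> G\<lparr>carrier := H i\<rparr>"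
    using assms(3) unfolding subnormal_def by blast
  have sub: "subgroup (H i) G" if "i \<le> l" for i
    using that
  proof (induction i)
    case 0
    show ?case by (simp add: H subgroup_self)
  next
    case (Suc i)
    thus ?case using H(3)[of i] normal_restrict_iff by simp
  qed
  have H_decreasing: "H j \<subseteq> H i" if "i \<le> j" "j \<le> l" for i j
    using that
  proof (induction j rule: dec_induct)
    case (step j)
    thus ?case using H(3)[of j] normal_restrict_iff[OF sub[of j]] by auto
  qed auto
  obtain k where k: "k \<in> K" "k \<noteq> \<one>"
    using nontrivial sub[of l] H(2) subgroup.one_closed by blast
  have "\<exists>P M h. subgroup P G \<and> M \<lhd> G\<lparr>carrier := P\<rparr> \<and> ?N i \<subseteq> P \<and> g \<in> M \<and>
          h \<in> P \<and> h \<in> H i \<and> (\<forall>n::nat. n > 0 \<longrightarrow> h [^] n \<notin> M)" if "i \<le> l" for i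
    using that
  proof (induction i)
    case 0
    obtain a b where "a \<in> B" "b \<in> B" "a \<noteq> b"
      using two_basis_elements assms(1) by blast
    then obtain M h where "M \<lhd> G" "g \<in> M" "h \<in> carrier G" "\<And>n::nat. n > 0 \<Longrightarrow> h [^] n \<notin> M"
      using exists_infinite_cyclic_quotient g by metis
    thus ?case
      using H(1) subgroup_self by (intro exI[of _ "carrier G"] exI[of _ M] exI[of _ h]) auto
  next
    case (Suc i)
    then obtain P M h where P: "subgroup P G" and M: "M \<lhd> G\<lparr>carrier := P\<rparr>" "?N i \<subseteq> P" "g \<in> M"
      and h: "h \<in> P" "h \<in> H i" "\<And>n::nat. n > 0 \<Longrightarrow> h [^] n \<notin> M"
      by auto
    have NM: "?N (Suc i) \<subseteq> M"
      using subnormal_closure_Suc_subset P M by blast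
    have kM: "k \<in> M"
      using NM subnormal_closure_antimono[OF g, of "Suc i" "Suc l"] Suc.prems k K by auto
    have MG: "subgroup M G" "\<And>x m. x \<in> P \<Longrightarrow> m \<in> M \<Longrightarrow> x \<otimes> m \<otimes> inv x \<in> M"
      using M P normal_restrict_iff by auto
    have hG: "h \<in> carrier G"
      using h P subgroup.mem_carrier by metis
    have power: "h [^] n \<in> P" "h [^] n \<in> H i" for n :: nat
    proof -
      show "h [^] n \<in> P"
        using h P by (induction n) (simp_all add: subgroup.one_closed subgroup.m_closed)
      show "h [^] n \<in> H i"
        using h sub[of i] Suc.prems
        by (induction n) (simp_all add: subgroup.one_closed subgroup.m_closed)
    qed
    have conj: "h [^] n \<otimes> k \<otimes> inv (h [^] n) \<in> M" "h [^] n \<otimes> k \<otimes> inv (h [^] n) \<in> H (Suc i)" for n :: nat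
    proof -
      show "h [^] n \<otimes> k \<otimes> inv (h [^] n) \<in> M"
        using MG power kM by simp
      have "k \<in> H (Suc i)"
        using H_decreasing[of "Suc i" l] Suc.prems k H by auto
      thus "h [^] n \<otimes> k \<otimes> inv (h [^] n) \<in> H (Suc i)"
        using H(3)[of i] normal_restrict_iff[OF sub[of i]] Suc.prems power by simp
    qed
    obtain n :: nat and M' where "M' \<lhd> G\<lparr>carrier := M\<rparr>" "g \<in> M'"
      "\<And>j. j > 0 \<Longrightarrow> (h [^] n \<otimes> k \<otimes> inv (h [^] n)) [^] (j::nat) \<notin> M'"
      using conjugate_avoiding_kernel[OF MG(1) M(3) kM k(2) hG h(3) conj(1)] by metis
    thus ?case
      using MG(1) NM conj by blast
  qed
  from this[of l] obtain P M h where P: "subgroup P G" "M \<lhd> G\<lparr>carrier := P\<rparr>" "?N l \<subseteq> P" "g \<in> M"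
    and h: "h \<in> P" "h \<in> K" "\<And>n::nat. n > 0 \<Longrightarrow> h [^] n \<notin> M"
    using H(2) by auto
  have "h \<in> M"
    using subnormal_closure_Suc_subset[OF P(1,2,4,3)] h K by auto
  moreover have "h \<in> carrier G"
    using h P subgroup.mem_carrier by metis
  ultimately show False
    using h(3)[of 1] by simp
qed

theorem corollary1p3:
  fixes F :: "('a, 'b) monoid_scheme" and g :: 'a and l :: nat
  assumes "free_group F" and "\<not> cyclic_group F" and "g \<in> carrier F" and "l \<ge> 1"
  shows "(\<forall>K. subnormal l K F \<and> K \<subseteq> subnormal_closure F g (l + 1) \<longrightarrow> K = {\<one>\<^bsub>F\<^esub>}) \<and>
         (\<forall>N. N \<lhd> F \<and> N \<subseteq> subnormal_closure F g (l + 1) \<longrightarrow> N = {\<one>\<^bsub>F\<^esub>})"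
proof -
  obtain B where "group F" "free_basis F B"
    using assms(1) unfolding free_group_def by blast
  then interpret group_with_free_basis F B
    by (simp add: group_with_free_basis_def group_with_free_basis_axioms_def)
  have "K = {\<one>\<^bsub>F\<^esub>}" if "subnormal l K F" "K \<subseteq> subnormal_closure F g (l + 1)" for K
    using subnormal_subgroup_trivial[OF assms(2,3) that(1)] that(2) by simp
  thus ?thesis
    using subnormal_of_normal[OF _ assms(4)] by blast
qed

end
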